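(* Let $\mathcal{V}(\cdot)=\mathbb{E}[v(\cdot)]$, where $v=\phi^*$, and let $M_N\in\mathcal{M}$, $\sigma>0$, $\varepsilon\ge0$. Suppose $v$ and $\psi$ are both finite valued and satisfy the ($\Delta_2$) condition, i.e., there exist $x_0>0$ and $k\in\mathbb{R}$ such that $$v(2x)<k\,v(x)\quad\text{and}\quad\psi(2x)<k\,\psi(x)\qquad\forall\,x\ge x_0.$$ Then variational densities (maximizers) exist for both the GVI problem $$\sup_{p\in\mathfrak{D}}\{\mathbb{E}[pM_N]-\sigma\mathbb{E}[\phi(p)]\}$$ and the CGVI problem $$\sup_{p\in\mathfrak{D}}\{\mathbb{E}[pM_N]\;:\;\mathbb{E}[\phi(p)]\le\varepsilon\}.$$
   Context: $(\Theta,\mathcal{B},\Pi)$ is a complete probability space, $\mathbb{E}$ is expectation with respect to $\Pi$, and $\mathfrak{D}$ is the set of $\mathcal{B}$-measurable $p\ge0$ with $\mathbb{E}[p]=1$. $\phi:\mathbb{R}\to[0,+\infty]$ is proper, closed and convex with $\phi(1)=0$ and $\phi(t)=+\infty$ for $t<0$. Its conjugate $v=\phi^*$ is a risk-averse disutility function: convex, increasing (in the weak sense), $v(x)\ge x$ for all $x\in\mathbb{R}$ with $v(x)=x$ if and only if $x=0$; moreover $v(t)<+\infty$ for some $t>0$. Set $\psi(x)=v^\#(x)=\sup_{t\ge0}\{tx-v(t)\}$ and $\psi^\#(t)=\sup_{x\ge0}\{tx-\psi(x)\}$ (which equals $v(t)$ for $t\ge0$). For such a function $g$, the Orlicz space $L_g$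 consists of the (a.s. equivalence classes of) $\mathcal{B}$-measurable $X$ with $\mathbb{E}[g(|X|/a)]<\infty$ for some $a>0$, with Luxemburg norm $\inf\{a>0:\mathbb{E}[g(|X|/a)]\le1\}$. Take $\mathcal{L}=L_\psi$ (the space of densities) and $\mathcal{M}=L_{\psi^\#}$ (the space of pay-offs), paired by $\langle p,X\rangle=\mathbb{E}[pX]$. $M_N(\theta)=\frac1N\sum_{n=1}^Nm(\theta,y_n)$ is the pay-off function for fixed data $y_1,\dots,y_N$. A density $p$ with $\mathbb{E}[\phi(p)]=+\infty$ has GVI objective value $-\infty$. *)

theory Defs
  imports "HOL-Probability.Probability"
begin

text \<open>
  Extended-valued functions on the real line have type \<open>real \<Rightarrow> ereal\<close>.  Since the library's
  \<^const>\<open>epigraph\<close> and \<^const>\<open>convex_on\<close> only cover real-valued functions, closedness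
  and convexity are defined through the epigraph below.
\<close>

definition ereal_epigraph :: "(real \<Rightarrow> ereal) \<Rightarrow> (real \<times> real) set" where
  "ereal_epigraph f = {(t, r). f t \<le> ereal r}"

definition proper_fun :: "(real \<Rightarrow> ereal) \<Rightarrow> bool" where
  "proper_fun f \<longleftrightarrow> (\<exists>t. f t < \<infinity>) \<and> (\<forall>t. - \<infinity> < f t)"

definition closed_fun :: "(real \<Rightarrow> ereal) \<Rightarrow> bool" where
  "closed_fun f \<longleftrightarrow> closed (ereal_epigraph f)"

definition convex_fun :: "(real \<Rightarrow> ereal) \<Rightarrow> bool" where
  "convex_fun f \<longleftrightarrow> convex (ereal_epigraph f)"

definition conjugate :: "(real \<Rightarrow> ereal) \<Rightarrow> real \<Rightarrow> ereal" where
  "conjugate f x = (SUP t. ereal (x * t) - f t)"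

definition sharp_conjugate :: "(real \<Rightarrow> ereal) \<Rightarrow> real \<Rightarrow> ereal" where
  "sharp_conjugate f x = (SUP t\<in>{0..}. ereal (t * x) - f t)"

definition risk_averse_disutility :: "(real \<Rightarrow> ereal) \<Rightarrow> bool" where
  "risk_averse_disutility v \<longleftrightarrow>
     convex_fun v \<and> mono v \<and> (\<forall>x. ereal x \<le> v x) \<and> (\<forall>x. v x = ereal x \<longleftrightarrow> x = 0)"

definition finite_valued :: "(real \<Rightarrow> ereal) \<Rightarrow> bool" where
  "finite_valued f \<longleftrightarrow> (\<forall>x. \<bar>f x\<bar> \<noteq> \<infinity>)"

text \<open>
  The expectation of a \<open>[0, \<infinity>]\<close>-valued function; \<^const>\<open>e2ennreal\<close> truncates negative
  values, so this is to be used for nonnegative \<open>f\<close> only.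
\<close>

definition nn_expectation :: "'a measure \<Rightarrow> ('a \<Rightarrow> ereal) \<Rightarrow> ereal" where
  "nn_expectation P f = enn2ereal (\<integral>\<^sup>+ \<theta>. e2ennreal (f \<theta>) \<partial>P)"

text \<open>
  Elements of Orlicz spaces are represented by measurable functions, without passing to
  almost sure equivalence classes.
\<close>

definition orlicz_space :: "'a measure \<Rightarrow> (real \<Rightarrow> ereal) \<Rightarrow> ('a \<Rightarrow> real) set" where
  "orlicz_space P g =
     {X \<in> borel_measurable P. \<exists>a>0. nn_expectation P (\<lambda>\<theta>. g (\<bar>X \<theta>\<bar> / a)) < \<infinity>}"

definition densities :: "'a measure \<Rightarrow> ('a \<Rightarrow> real) set" where
  "densities P =
     {p \<in> borel_measurable P. (\<forall>\<theta>\<in>space P. 0 \<le> p \<theta>) \<and> integrable P p \<and> (\<integral>\<theta>. p \<theta> \<partial>P) = 1}"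

definition empirical_payoff :: "('a \<Rightarrow> 'y \<Rightarrow> real) \<Rightarrow> (nat \<Rightarrow> 'y) \<Rightarrow> nat \<Rightarrow> 'a \<Rightarrow> real" where
  "empirical_payoff m y N \<theta> = 1 / real N * (\<Sum>n = 1..N. m \<theta> (y n))"

text \<open>
  For \<open>\<sigma> > 0\<close> the value is \<open>-\<infinity>\<close> as soon as the expectation of \<open>\<phi> \<circ> p\<close> is infinite,
  whether or not \<open>p X\<close> is integrable.  If that expectation is finite and \<open>X\<close> lies in the
  Orlicz space of pay-offs, then \<open>p X\<close> is integrable by Young's inequality, so the default
  value 0 of the Bochner integral plays no role.
\<close>

definition gvi_objective ::
    "'a measure \<Rightarrow> (real \<Rightarrow> ereal) \<Rightarrow> real \<Rightarrow> ('a \<Rightarrow> real) \<Rightarrow> ('a \<Rightarrow> real) \<Rightarrow> ereal" where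
  "gvi_objective P \<phi> \<sigma> X p =
     ereal (\<integral>\<theta>. p \<theta> * X \<theta> \<partial>P) - ereal \<sigma> * nn_expectation P (\<lambda>\<theta>. \<phi> (p \<theta>))"

definition cgvi_feasible ::
    "'a measure \<Rightarrow> (real \<Rightarrow> ereal) \<Rightarrow> real \<Rightarrow> ('a \<Rightarrow> real) \<Rightarrow> bool" where
  "cgvi_feasible P \<phi> \<epsilon> p \<longleftrightarrow>
     p \<in> densities P \<and> nn_expectation P (\<lambda>\<theta>. \<phi> (p \<theta>)) \<le> ereal \<epsilon>"

end

theory Submission
  imports Defs
begin

text \<open>
  Young's inequality \<open>\<tau> \<phi>(p) \<ge> p X - \<tau> v(X / \<tau>)\<close>, applied to \<open>X\<close> and \<open>-X\<close> with \<open>\<tau>\<close> small, makes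
  \<open>p X\<close> uniformly integrable along densities with bounded \<open>E[\<phi>(p)]\<close>: the
  condition \<open>\<Delta>\<^sub>2\<close> on \<open>v\<close> makes \<open>v(c X)\<close> integrable for every \<open>c\<close>.  Hence \<open>E[p X]\<close> is continuous under almost
  sure convergence on such densities (the case \<open>X = 1\<close> shows that the limit is again a density),
  while \<open>E[\<phi>(p)]\<close> is lower semicontinuous by Fatou's lemma.  Weak compactness is avoided:
  the sets of near-maximizers are convex and decreasing, and minimizing a strictly convex
  functional over them approximately yields an almost surely convergent maximizing sequence.
  Since \<open>E[p X] \<le> (\<sigma>/2) E[\<phi>(p)] + const\<close>, the GVI problem also reduces to a bound on \<open>E[\<phi>(p)]\<close>.
\<close>

section \<open>Almost sure convergence of near-minimizers over decreasing convex sets\<close>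

text \<open>The expected total variation of the sequence is finite, so almost every path has
  absolutely summable increments, and these telescope.\<close>

lemma AE_convergent_of_summable_increments:
  fixes u :: "nat \<Rightarrow> 'a \<Rightarrow> real"
  assumes [measurable]: "\<And>k. u k \<in> borel_measurable M"
    and bound: "\<And>k. (\<integral>\<^sup>+x. ennreal \<bar>u (Suc k) x - u k x\<bar> \<partial>M) \<le> ennreal (c k)"
    and c: "\<And>k. 0 \<le> c k" "summable c"
  shows "AE x in M. convergent (\<lambda>k. u k x)"
proof -
  have "(\<integral>\<^sup>+x. (\<Sum>k. ennreal \<bar>u (Suc k) x - u k x\<bar>) \<partial>M)
      = (\<Sum>k. \<integral>\<^sup>+x. ennreal \<bar>u (Suc k) x - u k x\<bar> \<partial>M)"
    by (intro nn_integral_suminf) simp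
  also have "\<dots> \<le> (\<Sum>k. ennreal (c k))"
    by (intro suminf_le bound summableI)
  also have "\<dots> = ennreal (\<Sum>k. c k)"
    using c by (intro suminf_ennreal2) auto
  finally have "(\<integral>\<^sup>+x. (\<Sum>k. ennreal \<bar>u (Suc k) x - u k x\<bar>) \<partial>M) \<noteq> \<infinity>"
    by (auto simp: top_unique)
  then have "AE x in M. (\<Sum>k. ennreal \<bar>u (Suc k) x - u k x\<bar>) \<noteq> \<infinity>"
    by (intro nn_integral_noteq_infinite) simp_all
  then show ?thesis
  proof eventually_elim
    case (elim x)
    then have "summable (\<lambda>k. \<bar>u (Suc k) x - u k x\<bar>)"
      by (intro summable_suminf_not_top) auto
    then have "summable (\<lambda>k. u (Suc k) x - u k x)"
      by (rule summable_rabs_cancel)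
    then have "convergent (\<lambda>n. u n x - u 0 x)"
      by (simp add: summable_iff_convergent sum_lessThan_telescope[of "\<lambda>n. u n x"])
    then have "convergent (\<lambda>n. (u n x - u 0 x) + u 0 x)"
      by (intro convergent_add convergent_const)
    then show ?case by simp
  qed
qed

context prob_space
begin

text \<open>Near-minimizers of the strictly convex functional \<open>p \<mapsto> E[exp (- p)]\<close> over decreasing
  convex sets: since
  \<open>(exp (- a) + exp (- b)) / 2 - exp (- (a + b) / 2) = (exp (- a / 2) - exp (- b / 2))\<^sup>2 / 2\<close>,
  the functions \<open>exp (- q k / 2)\<close> form a Cauchy sequence in \<open>L\<^sup>2\<close>.\<close>

lemma decreasing_convex_sets_exp_convergent:
  fixes A :: "nat \<Rightarrow> ('a \<Rightarrow> real) set"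
  assumes dec: "decseq A" and ne: "\<And>n. A n \<noteq> {}"
    and meas: "\<And>n p. p \<in> A n \<Longrightarrow> p \<in> borel_measurable M"
    and nonneg: "\<And>n p x. p \<in> A n \<Longrightarrow> x \<in> space M \<Longrightarrow> 0 \<le> p x"
    and mid: "\<And>n p q. p \<in> A n \<Longrightarrow> q \<in> A n \<Longrightarrow> (\<lambda>x. (p x + q x) / 2) \<in> A n"
  obtains q where "\<And>k. q k \<in> A k" "AE x in M. convergent (\<lambda>k. exp (- (q k x / 2)))"
proof -
  define \<kappa> where "\<kappa> p = (\<integral>x. exp (- p x) \<partial>M)" for p :: "'a \<Rightarrow> real"
  define s where "s n = (INF p\<in>A n. \<kappa> p)" for n
  have int: "integrable M (\<lambda>x. exp (- p x))" if "p \<in> A n" for p n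
    using meas[OF that] nonneg[OF that] by (intro integrable_const_bound[where B=1]) auto
  have \<kappa>_nonneg: "0 \<le> \<kappa> p" for p
    unfolding \<kappa>_def by (intro integral_nonneg_AE) auto
  have \<kappa>_le_1: "\<kappa> p \<le> 1" if "p \<in> A n" for p n
    unfolding \<kappa>_def using int[OF that] nonneg[OF that] prob_space
    by (intro integral_le_const) auto
  have bdd: "bdd_below (\<kappa> ` A n)" for n
    using \<kappa>_nonneg by (intro bdd_belowI[where m=0]) auto
  have s_le: "s n \<le> \<kappa> p" if "p \<in> A n" for p n
    unfolding s_def using bdd that by (intro cINF_lower) auto
  have "s n \<le> 1" for n
    using ne[of n] s_le \<kappa>_le_1 by (meson equals0I order_trans)
  moreover have inc: "incseq s"
    unfolding s_def incseq_def using dec ne bdd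
    by (auto intro!: cINF_superset_mono simp: decseq_def)
  ultimately obtain l where l: "s \<longlonglongrightarrow> l" "\<And>n. s n \<le> l"
    using incseq_convergent[OF inc] by metis
  have "\<exists>n\<ge>k. l - (1/4)^k < s n" for k
  proof -
    have "eventually (\<lambda>n. l - (1/4)^k < s n) sequentially"
      using l(1) by (rule order_tendstoD) simp
    then show ?thesis
      by (metis eventually_sequentially nle_le)
  qed
  \<comment> \<open>The indices satisfy \<open>n k \<ge> k\<close> so that \<open>q k\<close> will
    lie in \<open>A k\<close>. The gap (1/4)^k is the square of the rate (1/2)^k wanted for the L1
    increments.\<close>
  then obtain n where n: "\<And>k. n k \<ge> k" "\<And>k. l - (1/4)^k < s (n k)"
    by metis
  have "\<exists>p\<in>A (n k). \<kappa> p < s (n k) + (1/4)^k" for k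
    using cINF_less_iff[OF ne bdd, of "n k" "s (n k) + (1/4)^k"] by (simp add: s_def)
  then obtain q where q: "\<And>k. q k \<in> A (n k)" "\<And>k. \<kappa> (q k) < s (n k) + (1/4)^k"
    by metis
  have \<kappa>q: "\<kappa> (q k) \<le> l + (1/4)^k" for k
    using q(2)[of k] l(2)[of "n k"] by linarith
  define u where "u k x = exp (- (q k x / 2))" for k x
  have [measurable]: "q k \<in> borel_measurable M" for k
    using meas q(1) by blast
  have [measurable]: "u k \<in> borel_measurable M" for k
    unfolding u_def by measurable
  have sq: "u k x ^ 2 = exp (- q k x)" for k x
    by (simp add: u_def power2_eq_square flip: exp_add)
  have prd: "u k x * u j x = exp (- ((q k x + q j x) / 2))" for k j x
    by (simp add: u_def field_simps flip: exp_add)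
  have L1: "(\<integral>\<^sup>+x. ennreal \<bar>u (Suc k) x - u k x\<bar> \<partial>M) \<le> ennreal (3 * (1/2)^k)" for k
  proof -
    \<comment> \<open>The midpoint is formed in the larger set \<open>A j\<close>, which contains
      both functions; its infimum \<open>s j\<close> is one of the two already known to be close to
      \<open>l\<close>.\<close>
    define j where "j = min (n k) (n (Suc k))"
    let ?m = "\<lambda>x. (q k x + q (Suc k) x) / 2"
    have mid_in: "?m \<in> A j"
      using q(1)[of k] q(1)[of "Suc k"] decseqD[OF dec, of j "n k"] decseqD[OF dec, of j "n (Suc k)"]
      unfolding j_def by (intro mid) auto
    have four: "(1/4::real)^Suc k \<le> (1/4)^k" by simp
    have "l - (1/4)^k \<le> s (n k)" "l - (1/4)^k \<le> s (n (Suc k))"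
      using n(2)[of k] n(2)[of "Suc k"] four by linarith+
    then have "l - (1/4)^k \<le> s j"
      by (simp add: j_def min_def)
    then have \<kappa>m: "l - (1/4)^k \<le> \<kappa> ?m"
      using s_le[OF mid_in] by linarith
    let ?g = "\<lambda>x. exp (- q (Suc k) x) + exp (- q k x) - 2 * exp (- ?m x)"
    have g: "?g x = (u (Suc k) x - u k x)^2" for x
      using prd[of k x "Suc k"] by (simp add: power2_diff sq algebra_simps)
    have ig: "integrable M ?g"
      using int[OF q(1)] int[OF mid_in] by simp
    have "(\<integral>x. ?g x \<partial>M) = \<kappa> (q (Suc k)) + \<kappa> (q k) - 2 * \<kappa> ?m"
      unfolding \<kappa>_def using int[OF q(1)] int[OF mid_in] by simp
    \<comment> \<open>Both values of \<kappa> exceed \<open>l\<close> by at most (1/4)^k and the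
      midpoint, counted twice, falls below \<open>l\<close> by at most as much: four errors in
      total.\<close>
    also have "\<dots> \<le> 4 * (1/4)^k"
      using \<kappa>m \<kappa>q[of k] \<kappa>q[of "Suc k"] four by linarith
    finally have Ig: "(\<integral>x. ?g x \<partial>M) \<le> 4 * (1/4)^k" .
    \<comment> \<open>The weight 2^k balances the two terms: a squared L2 bound of order (1/4)^k
      becomes an L1 bound of order (1/2)^k.\<close>
    have pw: "\<bar>z\<bar> \<le> 2^k * z^2 / 2 + (1/2)^k / 2" for z :: real
    proof -
      have "0 \<le> (2^k * \<bar>z\<bar> - 1)^2" by simp
      also have "\<dots> = 2^k * (2^k * z^2 + (1/2)^k - 2 * \<bar>z\<bar>)"
        by (simp add: power2_eq_square algebra_simps power_one_over)
      finally have "0 \<le> 2^k * z^2 + (1/2)^k - 2 * \<bar>z\<bar>"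
        by (metis zero_le_mult_iff not_le zero_less_power zero_less_numeral)
      then show ?thesis by (simp add: field_simps)
    qed
    have "(\<integral>\<^sup>+x. ennreal \<bar>u (Suc k) x - u k x\<bar> \<partial>M)
        \<le> (\<integral>\<^sup>+x. ennreal (2^k * ?g x / 2 + (1/2)^k / 2) \<partial>M)"
      unfolding g by (intro nn_integral_mono ennreal_leI pw)
    also have "\<dots> = ennreal (\<integral>x. 2^k * ?g x / 2 + (1/2)^k / 2 \<partial>M)"
      unfolding g using ig[unfolded g] by (intro nn_integral_eq_integral) auto
    also have "(\<integral>x. 2^k * ?g x / 2 + (1/2)^k / 2 \<partial>M) = 2^k * (\<integral>x. ?g x \<partial>M) / 2 + (1/2)^k / 2"
      unfolding g using ig[unfolded g] prob_space by simp
    also have "\<dots> \<le> 2^k * (4 * (1/4)^k) / 2 + (1/2)^k / 2"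
      by (intro add_mono divide_right_mono mult_left_mono Ig) auto
    also have "\<dots> = 5/2 * (1/2)^k"
      by (simp add: power_one_over field_simps flip: power_mult_distrib)
    also have "\<dots> \<le> 3 * (1/2)^k" by simp
    finally show ?thesis by (simp add: ennreal_leI)
  qed
  have "AE x in M. convergent (\<lambda>k. u k x)"
    by (rule AE_convergent_of_summable_increments[where c="\<lambda>k. 3 * (1/2)^k"])
      (auto intro!: summable_mult L1)
  moreover have "q k \<in> A k" for k
    using q(1)[of k] n(1)[of k] dec by (auto simp: decseq_def)
  ultimately show ?thesis
    using that[of q] by (simp add: u_def)
qed

text \<open>Convergence of the exponentials amounts to convergence of \<open>q k x\<close> in
  [0, \<infinity>]; Fatou's lemma with the uniform bound on the integrals excludes the limit
  \<infinity> almost everywhere.\<close>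

lemma decreasing_convex_sets_AE_convergent:
  fixes A :: "nat \<Rightarrow> ('a \<Rightarrow> real) set"
  assumes dec: "decseq A" and ne: "\<And>n. A n \<noteq> {}"
    and meas: "\<And>n p. p \<in> A n \<Longrightarrow> p \<in> borel_measurable M"
    and nonneg: "\<And>n p x. p \<in> A n \<Longrightarrow> x \<in> space M \<Longrightarrow> 0 \<le> p x"
    and mid: "\<And>n p q. p \<in> A n \<Longrightarrow> q \<in> A n \<Longrightarrow> (\<lambda>x. (p x + q x) / 2) \<in> A n"
    and bound: "\<And>n p. p \<in> A n \<Longrightarrow> (\<integral>\<^sup>+x. ennreal (p x) \<partial>M) \<le> ennreal c"
  obtains q p where "\<And>k. q k \<in> A k" "p \<in> borel_measurable M" "\<And>x. 0 \<le> p x"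
    "AE x in M. (\<lambda>k. q k x) \<longlonglongrightarrow> p x"
proof -
  obtain q where q: "\<And>k. q k \<in> A k" "AE x in M. convergent (\<lambda>k. exp (- (q k x / 2)))"
    by (rule decreasing_convex_sets_exp_convergent[of A]) (use dec ne meas nonneg mid in auto)
  have [measurable]: "q k \<in> borel_measurable M" for k
    using meas q(1) by blast
  have "(\<integral>\<^sup>+x. liminf (\<lambda>k. ennreal (q k x)) \<partial>M) \<le> liminf (\<lambda>k. \<integral>\<^sup>+x. ennreal (q k x) \<partial>M)"
    by (intro nn_integral_liminf) simp
  also have "\<dots> \<le> liminf (\<lambda>k::nat. ennreal c)"
    using bound q(1) by (intro Liminf_mono always_eventually) blast
  also have "\<dots> = ennreal c" by (simp add: Liminf_const)
  finally have "(\<integral>\<^sup>+x. liminf (\<lambda>k. ennreal (q k x)) \<partial>M) \<noteq> \<infinity>"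
    by (auto simp: top_unique)
  then have "AE x in M. liminf (\<lambda>k. ennreal (q k x)) \<noteq> \<infinity>"
    by (intro nn_integral_noteq_infinite) simp_all
  \<comment> \<open>The absolute value makes the limit function nonnegative also on the null set
    where \<open>lim\<close> is arbitrary.\<close>
  with q(2) have conv: "AE x in M. (\<lambda>k. q k x) \<longlonglongrightarrow> \<bar>lim (\<lambda>k. q k x)\<bar>"
    using AE_space
  proof eventually_elim
    case (elim x)
    then obtain l where l: "(\<lambda>k. exp (- (q k x / 2))) \<longlonglongrightarrow> l"
      by (auto simp: convergent_def)
    have "l \<ge> 0" by (rule LIMSEQ_le_const[OF l]) auto
    \<comment> \<open>A zero limit would force \<open>q k x\<close> to tend to infinity, against the
      finite \<open>liminf\<close>.\<close>
    have "l \<noteq> 0"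
    proof
      assume "l = 0"
      have "filterlim (\<lambda>k. exp (- (q k x / 2))) (at_right 0) sequentially"
        using l \<open>l = 0\<close> by (auto simp: filterlim_at eventually_sequentially)
      then have "filterlim (\<lambda>k. ln (exp (- (q k x / 2)))) at_bot sequentially"
        by (rule filterlim_compose[OF ln_at_0])
      then have "filterlim (\<lambda>k. q k x / 2) at_top sequentially"
        by (simp add: filterlim_uminus_at_top)
      then have "filterlim (\<lambda>k. 2 * (q k x / 2)) at_top sequentially"
        by (intro filterlim_tendsto_pos_mult_at_top[OF tendsto_const]) auto
      then have "(\<lambda>k. ennreal (q k x)) \<longlonglongrightarrow> \<infinity>"
        by (simp add: ennreal_tendsto_top_eq_at_top)
      then show False
        using elim(2) lim_imp_Liminf[OF sequentially_bot] by blast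
    qed
    then have "(\<lambda>k. - 2 * ln (exp (- (q k x / 2)))) \<longlonglongrightarrow> - 2 * ln l"
      using l by (intro tendsto_intros) auto
    then have *: "(\<lambda>k. q k x) \<longlonglongrightarrow> - 2 * ln l" by simp
    moreover have "0 \<le> - 2 * ln l"
      using nonneg[OF q(1) elim(3)] by (intro LIMSEQ_le_const[OF *]) auto
    ultimately show ?case by (simp add: limI)
  qed
  show ?thesis
    by (rule that[of q "\<lambda>x. \<bar>lim (\<lambda>k. q k x)\<bar>"]) (use q conv in auto)
qed

section \<open>Convergence of integrals under uniform integrability\<close>

text \<open>A form of Vitali's theorem: truncation at an integrable function \<open>B\<close> costs
  at most the excess over \<open>B\<close>, uniformly in \<open>k\<close>, and dominated convergence
  handles the truncated functions.\<close>

lemma integral_tendsto_of_uniform_excess: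
  fixes Z :: "nat \<Rightarrow> 'a \<Rightarrow> real"
  assumes int: "\<And>k. integrable M (Z k)" "integrable M Y"
    and conv: "AE x in M. (\<lambda>k. Z k x) \<longlonglongrightarrow> Y x"
    and excess: "\<And>e. 0 < e \<Longrightarrow> \<exists>B. integrable M B \<and> (\<forall>x. 0 \<le> B x) \<and>
      (\<forall>k. (\<integral>x. max 0 (\<bar>Z k x\<bar> - B x) \<partial>M) \<le> e) \<and> (\<integral>x. max 0 (\<bar>Y x\<bar> - B x) \<partial>M) \<le> e"
  shows "(\<lambda>k. \<integral>x. Z k x \<partial>M) \<longlonglongrightarrow> (\<integral>x. Y x \<partial>M)"
proof (rule LIMSEQ_I)
  fix r :: real assume "0 < r"
  then obtain B where B: "integrable M B" "\<And>x. 0 \<le> B x"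
    "\<And>k. (\<integral>x. max 0 (\<bar>Z k x\<bar> - B x) \<partial>M) \<le> r/4" "(\<integral>x. max 0 (\<bar>Y x\<bar> - B x) \<partial>M) \<le> r/4"
    using excess[of "r/4"] by auto
  let ?clip = "\<lambda>z x. max (- B x) (min (B x) (z x))"
  have clip: "integrable M (?clip z)" "\<bar>(\<integral>x. z x \<partial>M) - (\<integral>x. ?clip z x \<partial>M)\<bar> \<le> e"
    if z: "integrable M z" and e: "(\<integral>x. max 0 (\<bar>z x\<bar> - B x) \<partial>M) \<le> e" for z e
  proof -
    show i: "integrable M (?clip z)"
      using z B(1) by (intro integrable_max integrable_min) auto
    have "\<bar>(\<integral>x. z x \<partial>M) - (\<integral>x. ?clip z x \<partial>M)\<bar> = \<bar>\<integral>x. z x - ?clip z x \<partial>M\<bar>"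
      using i z by simp
    also have "\<dots> \<le> (\<integral>x. \<bar>z x - ?clip z x\<bar> \<partial>M)" by (rule integral_abs_bound)
    also have "\<dots> = (\<integral>x. max 0 (\<bar>z x\<bar> - B x) \<partial>M)"
    proof (intro Bochner_Integration.integral_cong refl)
      fix x show "\<bar>z x - ?clip z x\<bar> = max 0 (\<bar>z x\<bar> - B x)"
        using B(2)[of x] by (auto simp: max_def min_def)
    qed
    finally show "\<bar>(\<integral>x. z x \<partial>M) - (\<integral>x. ?clip z x \<partial>M)\<bar> \<le> e" using e by simp
  qed
  have "(\<lambda>k. \<integral>x. ?clip (Z k) x \<partial>M) \<longlonglongrightarrow> (\<integral>x. ?clip Y x \<partial>M)"
  proof (rule integral_dominated_convergence[where w=B])
    show "AE x in M. (\<lambda>k. ?clip (Z k) x) \<longlonglongrightarrow> ?clip Y x"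
      using conv by eventually_elim (intro tendsto_intros)
    show "AE x in M. norm (?clip (Z k) x) \<le> B x" for k
    proof (rule AE_I2)
      fix x show "norm (?clip (Z k) x) \<le> B x"
        using B(2)[of x] by (auto simp: max_def min_def)
    qed
  qed (use int B(1) in auto)
  \<comment> \<open>The error budget is r/2 for the truncated integrals and r/4 for each of the two
    truncations.\<close>
  then obtain k0 where k0: "\<And>k. k \<ge> k0 \<Longrightarrow> \<bar>(\<integral>x. ?clip (Z k) x \<partial>M) - (\<integral>x. ?clip Y x \<partial>M)\<bar> < r/2"
    using \<open>0 < r\<close> unfolding LIMSEQ_def dist_real_def by (meson half_gt_zero)
  have "norm ((\<integral>x. Z k x \<partial>M) - (\<integral>x. Y x \<partial>M)) < r" if "k \<ge> k0" for k
    using k0[OF that] clip(2)[OF int(1)[of k] B(3)[of k]] clip(2)[OF int(2) B(4)]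
    unfolding real_norm_def by linarith
  then show "\<exists>k0. \<forall>k\<ge>k0. norm ((\<integral>x. Z k x \<partial>M) - (\<integral>x. Y x \<partial>M)) < r" by blast
qed

end

section \<open>Lower semicontinuous convex integrands of superlinear growth\<close>

text \<open>Here \<open>f\<close> stands for \<phi> and \<open>w\<close> for its conjugate. As
  \<open>w\<close> is real at every slope \<open>x\<close>, Young's inequality forces
  \<open>f\<close> to outgrow every linear function in both directions.\<close>

locale superlinear_integrand = prob_space M
  for M :: "'a measure" +
  fixes f :: "real \<Rightarrow> ennreal" and w :: "real \<Rightarrow> real"
  assumes closed_sublevel: "closed {t. f t \<le> c}"
    and midpoint_convex: "2 * f ((a + b) / 2) \<le> f a + f b"
    and Young: "ennreal (x * t - w x) \<le> f t"
begin

lemma f_measurable [measurable]: "f \<in> borel_measurable borel"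
  using closed_sublevel by (intro borel_measurableI_le) (auto intro: borel_closed)

text \<open>If \<open>c < f t\<close>, the complement of the closed sublevel set at \<open>c\<close>
  is a neighbourhood of \<open>t\<close> and eventually contains \<open>X n\<close>.\<close>

lemma f_lower_semicontinuous:
  assumes "X \<longlonglongrightarrow> t"
  shows "f t \<le> liminf (\<lambda>n. f (X n))"
  unfolding le_Liminf_iff
proof (intro allI impI)
  fix c assume "c < f t"
  then have "open (- {t. f t \<le> c})" "t \<in> - {t. f t \<le> c}"
    using closed_sublevel by auto
  then have "eventually (\<lambda>n. X n \<in> - {t. f t \<le> c}) sequentially"
    using assms topological_tendstoD by blast
  then show "eventually (\<lambda>n. c < f (X n)) sequentially"
    by eventually_elim auto
qed

lemma nn_integral_f_liminf:
  assumes [measurable]: "\<And>k. q k \<in> borel_measurable M"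
    and "AE x in M. (\<lambda>k. q k x) \<longlonglongrightarrow> p x"
  shows "(\<integral>\<^sup>+x. f (p x) \<partial>M) \<le> liminf (\<lambda>k. \<integral>\<^sup>+x. f (q k x) \<partial>M)"
proof -
  have "(\<integral>\<^sup>+x. f (p x) \<partial>M) \<le> (\<integral>\<^sup>+x. liminf (\<lambda>k. f (q k x)) \<partial>M)"
    using assms(2) by (intro nn_integral_mono_AE) (auto elim!: eventually_mono intro: f_lower_semicontinuous)
  also have "\<dots> \<le> liminf (\<lambda>k. \<integral>\<^sup>+x. f (q k x) \<partial>M)"
    by (intro nn_integral_liminf) simp
  finally show ?thesis .
qed

section \<open>Pay-offs and their uniform integrability\<close>

text \<open>Integrability is demanded at every scale \<open>c\<close>, as for the heart of an Orlicz
  space: the envelope uses the scales 1 / \<tau> with both signs and arbitrarily small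
  \<tau>.\<close>

definition payoff :: "('a \<Rightarrow> real) \<Rightarrow> bool" where
  "payoff X \<longleftrightarrow> X \<in> borel_measurable M \<and> (\<forall>c. integrable M (\<lambda>x. w (c * X x)))"

lemma payoff_measurable: "payoff X \<Longrightarrow> X \<in> borel_measurable M"
  by (simp add: payoff_def)

lemma payoff_const: "payoff (\<lambda>_. a)"
  by (simp add: payoff_def)

definition envelope :: "('a \<Rightarrow> real) \<Rightarrow> real \<Rightarrow> 'a \<Rightarrow> real" where
  "envelope X \<tau> x = \<tau> * (\<bar>w (1 / \<tau> * X x)\<bar> + \<bar>w (- 1 / \<tau> * X x)\<bar>)"

lemma envelope_nonneg: "0 \<le> \<tau> \<Longrightarrow> 0 \<le> envelope X \<tau> x"
  by (simp add: envelope_def)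

lemma integrable_envelope:
  assumes "payoff X"
  shows "integrable M (envelope X \<tau>)"
proof -
  have w: "integrable M (\<lambda>x. w (c * X x))" for c
    using assms by (simp add: payoff_def)
  show ?thesis
    unfolding envelope_def[abs_def]
    by (intro integrable_mult_right Bochner_Integration.integrable_add integrable_abs w)
qed

text \<open>Young's inequality at slope X / \<tau> or -X / \<tau>, multiplied by \<tau>. The sign is
  chosen so that the linear term is the absolute value of \<open>t * X x\<close>;
  \<open>ennreal\<close> cuts off negative excess.\<close>

lemma excess_le:
  assumes "0 < \<tau>"
  shows "ennreal (\<bar>t * X x\<bar> - envelope X \<tau> x) \<le> ennreal \<tau> * f t"
proof -
  have *: "ennreal (\<tau> * (y * t - w y)) \<le> ennreal \<tau> * f t" for y
    using assms Young[of y t] by (subst ennreal_mult') (auto intro: mult_left_mono)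
  define y where "y = (if 0 \<le> t * X x then 1 / \<tau> * X x else - 1 / \<tau> * X x)"
  have "\<tau> * (y * t) = \<bar>t * X x\<bar>"
    using assms by (auto simp: y_def)
  moreover have "\<tau> * w y \<le> envelope X \<tau> x"
    unfolding envelope_def using assms by (intro mult_left_mono) (auto simp: y_def)
  ultimately have "\<bar>t * X x\<bar> - envelope X \<tau> x \<le> \<tau> * (y * t - w y)"
    by (simp add: right_diff_distrib)
  then show ?thesis
    using *[of y] ennreal_leI order_trans by blast
qed

lemma nn_integral_excess_le:
  assumes [measurable]: "p \<in> borel_measurable M" and "0 < \<tau>" "0 \<le> C"
    and "(\<integral>\<^sup>+x. f (p x) \<partial>M) \<le> ennreal C"
  shows "(\<integral>\<^sup>+x. ennreal (\<bar>p x * X x\<bar> - envelope X \<tau> x) \<partial>M) \<le> ennreal (\<tau> * C)"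
proof -
  have "(\<integral>\<^sup>+x. ennreal (\<bar>p x * X x\<bar> - envelope X \<tau> x) \<partial>M) \<le> (\<integral>\<^sup>+x. ennreal \<tau> * f (p x) \<partial>M)"
    using assms by (intro nn_integral_mono excess_le)
  also have "\<dots> = ennreal \<tau> * (\<integral>\<^sup>+x. f (p x) \<partial>M)"
    by (intro nn_integral_cmult) simp
  also have "\<dots> \<le> ennreal \<tau> * ennreal C"
    using assms(4) by (intro mult_left_mono) auto
  finally show ?thesis
    using assms by (simp add: ennreal_mult)
qed

text \<open>The envelope depends on \<open>X\<close> and \<tau> alone, while the excess bound
  \<open>\<tau> * C\<close> holds for all \<open>p\<close> with divergence at most \<open>C\<close>:
  this is the uniform integrability. The last bound later yields coercivity of the penalized
  objective.\<close>

lemma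
  assumes X: "payoff X" and p[measurable]: "p \<in> borel_measurable M" and C: "0 \<le> C"
    and fp: "(\<integral>\<^sup>+x. f (p x) \<partial>M) \<le> ennreal C"
  shows integrable_payoff: "integrable M (\<lambda>x. p x * X x)"
    and integral_excess_le: "0 < \<tau> \<Longrightarrow> (\<integral>x. max 0 (\<bar>p x * X x\<bar> - envelope X \<tau> x) \<partial>M) \<le> \<tau> * C"
    and integral_payoff_le: "0 < \<tau> \<Longrightarrow> (\<integral>x. p x * X x \<partial>M) \<le> \<tau> * C + (\<integral>x. envelope X \<tau> x \<partial>M)"
proof -
  note [measurable] = payoff_measurable[OF X] borel_measurable_integrable[OF integrable_envelope[OF X]]
  have ex: "integrable M (\<lambda>x. max 0 (\<bar>p x * X x\<bar> - envelope X \<tau> x))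
      \<and> (\<integral>x. max 0 (\<bar>p x * X x\<bar> - envelope X \<tau> x) \<partial>M) \<le> \<tau> * C" if "0 < \<tau>" for \<tau>
  proof -
    have *: "(\<integral>\<^sup>+x. ennreal (max 0 (\<bar>p x * X x\<bar> - envelope X \<tau> x)) \<partial>M) \<le> ennreal (\<tau> * C)"
      using nn_integral_excess_le[OF p that C fp, of X] by (simp add: ennreal_max_0)
    then have i: "integrable M (\<lambda>x. max 0 (\<bar>p x * X x\<bar> - envelope X \<tau> x))"
      by (intro integrableI_nonneg) (auto simp: top_unique less_top[symmetric])
    show ?thesis
      using i * that C by (subst (asm) nn_integral_eq_integral) auto
  qed
  have bound: "\<bar>p x * X x\<bar> \<le> envelope X \<tau> x + max 0 (\<bar>p x * X x\<bar> - envelope X \<tau> x)" for x \<tau>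
    by linarith
  \<comment> \<open>Envelope plus excess, taken at \<tau> = 1, is an integrable majorant of the
    product.\<close>
  have "integrable M (\<lambda>x. envelope X 1 x + max 0 (\<bar>p x * X x\<bar> - envelope X 1 x))"
    using ex[of 1] integrable_envelope[OF X, of 1] by simp
  then show i: "integrable M (\<lambda>x. p x * X x)"
    by (rule Bochner_Integration.integrable_bound)
      (use bound[of _ 1] in \<open>auto intro!: AE_I2 intro: order_trans[OF _ abs_ge_self]\<close>)
  assume \<tau>: "0 < \<tau>"
  then show "(\<integral>x. max 0 (\<bar>p x * X x\<bar> - envelope X \<tau> x) \<partial>M) \<le> \<tau> * C"
    using ex by blast
  have "(\<integral>x. p x * X x \<partial>M) \<le> (\<integral>x. envelope X \<tau> x + max 0 (\<bar>p x * X x\<bar> - envelope X \<tau> x) \<partial>M)"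
    using i ex[OF \<tau>] integrable_envelope[OF X]
    by (intro integral_mono) (auto intro: order_trans[OF abs_ge_self bound])
  also have "\<dots> \<le> \<tau> * C + (\<integral>x. envelope X \<tau> x \<partial>M)"
    using ex[OF \<tau>] integrable_envelope[OF X] by simp
  finally show "(\<integral>x. p x * X x \<partial>M) \<le> \<tau> * C + (\<integral>x. envelope X \<tau> x \<partial>M)" .
qed

lemma integral_payoff_tendsto:
  assumes X: "payoff X" and q: "\<And>k. q k \<in> borel_measurable M" and p: "p \<in> borel_measurable M"
    and C: "0 \<le> C" and fq: "\<And>k. (\<integral>\<^sup>+x. f (q k x) \<partial>M) \<le> ennreal C"
    and fp: "(\<integral>\<^sup>+x. f (p x) \<partial>M) \<le> ennreal C"
    and conv: "AE x in M. (\<lambda>k. q k x) \<longlonglongrightarrow> p x"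
  shows "(\<lambda>k. \<integral>x. q k x * X x \<partial>M) \<longlonglongrightarrow> (\<integral>x. p x * X x \<partial>M)"
proof (rule integral_tendsto_of_uniform_excess)
  show "integrable M (\<lambda>x. q k x * X x)" for k
    using integrable_payoff[OF X q C fq] .
  show "integrable M (\<lambda>x. p x * X x)"
    using integrable_payoff[OF X p C fp] .
  show "AE x in M. (\<lambda>k. q k x * X x) \<longlonglongrightarrow> p x * X x"
    using conv by eventually_elim (intro tendsto_intros)
  fix e :: real assume "0 < e"
  \<comment> \<open>The denominator \<open>C + 1\<close> keeps \<tau> positive when
    \<open>C = 0\<close>.\<close>
  define \<tau> where "\<tau> = e / (C + 1)"
  have \<tau>: "0 < \<tau>" "\<tau> * C \<le> e"
    using C \<open>0 < e\<close> by (auto simp: \<tau>_def field_simps)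
  show "\<exists>B. integrable M B \<and> (\<forall>x. 0 \<le> B x) \<and>
      (\<forall>k. (\<integral>x. max 0 (\<bar>q k x * X x\<bar> - B x) \<partial>M) \<le> e) \<and>
      (\<integral>x. max 0 (\<bar>p x * X x\<bar> - B x) \<partial>M) \<le> e"
    using \<tau> integrable_envelope[OF X, of \<tau>] envelope_nonneg[of \<tau> X]
      integral_excess_le[OF X q C fq \<tau>(1)] integral_excess_le[OF X p C fp \<tau>(1)]
    by (intro exI[of _ "envelope X \<tau>"]) (auto intro: order_trans)
qed

section \<open>Densities of bounded divergence\<close>

text \<open>\<open>enn2real\<close> sends an infinite integral to 0, so this value is faithful where
  the integral is finite, as on \<open>bounded_densities\<close>.\<close>

definition divergence :: "('a \<Rightarrow> real) \<Rightarrow> real" where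
  "divergence p = enn2real (\<integral>\<^sup>+x. f (p x) \<partial>M)"

definition bounded_densities :: "real \<Rightarrow> ('a \<Rightarrow> real) set" where
  "bounded_densities C = {p \<in> densities M. (\<integral>\<^sup>+x. f (p x) \<partial>M) \<le> ennreal C}"

lemma ennreal_divergence:
  "(\<integral>\<^sup>+x. f (p x) \<partial>M) \<le> ennreal C \<Longrightarrow> (\<integral>\<^sup>+x. f (p x) \<partial>M) = ennreal (divergence p)"
  unfolding divergence_def by (subst ennreal_enn2real_if) (auto simp: top_unique)

lemma divergence_nonneg: "0 \<le> divergence p"
  by (simp add: divergence_def)

lemma
  assumes p: "p \<in> bounded_densities C" and q: "q \<in> bounded_densities C" and C: "0 \<le> C"
  shows midpoint_bounded_densities: "(\<lambda>x. (p x + q x) / 2) \<in> bounded_densities C"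
    and divergence_midpoint: "divergence (\<lambda>x. (p x + q x) / 2) \<le> (divergence p + divergence q) / 2"
proof -
  let ?m = "\<lambda>x. (p x + q x) / 2"
  have [measurable]: "p \<in> borel_measurable M" "q \<in> borel_measurable M"
    using p q by (auto simp: bounded_densities_def densities_def)
  have fin: "(\<integral>\<^sup>+x. f (p x) \<partial>M) = ennreal (divergence p)" "(\<integral>\<^sup>+x. f (q x) \<partial>M) = ennreal (divergence q)"
    "divergence p \<le> C" "divergence q \<le> C"
    using p q ennreal_divergence[of p C] ennreal_divergence[of q C] C
    by (auto simp: bounded_densities_def ennreal_le_iff)
  have "2 * (\<integral>\<^sup>+x. f (?m x) \<partial>M) = (\<integral>\<^sup>+x. 2 * f (?m x) \<partial>M)"
    by (intro nn_integral_cmult[symmetric]) simp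
  also have "\<dots> \<le> (\<integral>\<^sup>+x. f (p x) + f (q x) \<partial>M)"
    by (intro nn_integral_mono midpoint_convex)
  also have "\<dots> = ennreal (divergence p + divergence q)"
    by (simp add: nn_integral_add fin divergence_nonneg)
  finally have 2: "2 * (\<integral>\<^sup>+x. f (?m x) \<partial>M) \<le> ennreal (divergence p + divergence q)" .
  \<comment> \<open>The factor 2 is cancelled by cases: an infinite integral would contradict the
    finite bound.\<close>
  have *: "(\<integral>\<^sup>+x. f (?m x) \<partial>M) \<le> ennreal ((divergence p + divergence q) / 2)"
  proof (cases "\<integral>\<^sup>+x. f (?m x) \<partial>M")
    case (real r)
    then have "ennreal (2 * r) \<le> ennreal (divergence p + divergence q)"
      using 2 by (simp add: ennreal_mult)
    then show ?thesis
      using real divergence_nonneg[of p] divergence_nonneg[of q]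
      by (simp add: ennreal_leI del: ennreal_plus)
  next
    case top
    then show ?thesis using 2 by (simp add: ennreal_mult_top top_unique del: ennreal_plus)
  qed
  then show "divergence ?m \<le> (divergence p + divergence q) / 2"
    unfolding divergence_def[of ?m] by (intro enn2real_leI) (auto simp: divergence_nonneg)
  have "(divergence p + divergence q) / 2 \<le> C" using fin by simp
  then have "(\<integral>\<^sup>+x. f (?m x) \<partial>M) \<le> ennreal C"
    using * ennreal_leI order_trans by blast
  then show "?m \<in> bounded_densities C"
    using p q by (auto simp: bounded_densities_def densities_def)
qed

lemma bounded_densities_closed:
  assumes q: "\<And>k. q k \<in> bounded_densities C" and C: "0 \<le> C"
    and p: "p \<in> borel_measurable M" "\<And>x. 0 \<le> p x"
    and conv: "AE x in M. (\<lambda>k. q k x) \<longlonglongrightarrow> p x"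
  shows "p \<in> bounded_densities C"
proof -
  have [measurable]: "q k \<in> borel_measurable M" and fq: "(\<integral>\<^sup>+x. f (q k x) \<partial>M) \<le> ennreal C"
    and q1: "(\<integral>x. q k x \<partial>M) = 1" for k
    using q[of k] by (auto simp: bounded_densities_def densities_def)
  have "(\<integral>\<^sup>+x. f (p x) \<partial>M) \<le> liminf (\<lambda>k. \<integral>\<^sup>+x. f (q k x) \<partial>M)"
    by (rule nn_integral_f_liminf) (use conv in auto)
  also have "\<dots> \<le> liminf (\<lambda>k::nat. ennreal C)"
    using fq by (intro Liminf_mono always_eventually) blast
  also have "\<dots> = ennreal C" by (simp add: Liminf_const)
  finally have fp: "(\<integral>\<^sup>+x. f (p x) \<partial>M) \<le> ennreal C" .
  \<comment> \<open>Pairing with the constant pay-off 1 shows that no mass is lost; Fatou's lemma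
    alone would give total mass at most 1.\<close>
  have "(\<lambda>k. \<integral>x. q k x * 1 \<partial>M) \<longlonglongrightarrow> (\<integral>x. p x * 1 \<partial>M)"
    by (rule integral_payoff_tendsto[OF payoff_const _ p(1) C fq fp conv]) simp
  then have "(\<integral>x. p x \<partial>M) = 1"
    by (simp add: q1 LIMSEQ_const_iff)
  then show ?thesis
    using p fp integrable_payoff[OF payoff_const[of 1] p(1) C fp]
    by (auto simp: bounded_densities_def densities_def)
qed

section \<open>Existence of maximizers under a divergence bound\<close>

text \<open>The objective is midpoint concave, so the sets \<open>A n\<close> of near-maximizers are
  closed under midpoints and admit an almost surely convergent selection. The pay-off term passes to
  the limit and the divergence is lower semicontinuous. The case \<sigma> = 0 serves the constrained
  problem.\<close>

theorem penalized_payoff_maximizer: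
  assumes X: "payoff X" and \<sigma>: "0 \<le> \<sigma>" and C: "0 \<le> C" and ne: "bounded_densities C \<noteq> {}"
  shows "\<exists>p\<in>bounded_densities C. \<forall>q\<in>bounded_densities C.
    (\<integral>x. q x * X x \<partial>M) - \<sigma> * divergence q \<le> (\<integral>x. p x * X x \<partial>M) - \<sigma> * divergence p"
proof -
  define J where "J p = (\<integral>x. p x * X x \<partial>M) - \<sigma> * divergence p" for p
  define S where "S = (SUP p\<in>bounded_densities C. J p)"
  define A where "A n = {p \<in> bounded_densities C. S - 1 / Suc n \<le> J p}" for n
  have D: "p \<in> borel_measurable M" "\<And>x. x \<in> space M \<Longrightarrow> 0 \<le> p x" "integrable M p"
    "(\<integral>x. p x \<partial>M) = 1" "(\<integral>\<^sup>+x. f (p x) \<partial>M) \<le> ennreal C" if "p \<in> bounded_densities C" for p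
    using that by (auto simp: bounded_densities_def densities_def)
  have bdd: "bdd_above (J ` bounded_densities C)"
  proof (rule bdd_aboveI2)
    fix p assume p: "p \<in> bounded_densities C"
    have "J p \<le> (\<integral>x. p x * X x \<partial>M)"
      using \<sigma> divergence_nonneg[of p] by (simp add: J_def)
    also have "\<dots> \<le> 1 * C + (\<integral>x. envelope X 1 x \<partial>M)"
      by (rule integral_payoff_le[OF X D(1)[OF p] C D(5)[OF p]]) simp
    finally show "J p \<le> 1 * C + (\<integral>x. envelope X 1 x \<partial>M)" .
  qed
  have J_le: "J p \<le> S" if "p \<in> bounded_densities C" for p
    unfolding S_def using bdd that by (intro cSUP_upper)
  have J_mid: "(J p + J q) / 2 \<le> J (\<lambda>x. (p x + q x) / 2)"
    if p: "p \<in> bounded_densities C" and q: "q \<in> bounded_densities C" for p q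
  proof -
    have "(\<integral>x. (p x + q x) / 2 * X x \<partial>M) = (\<integral>x. (p x * X x + q x * X x) / 2 \<partial>M)"
      by (intro Bochner_Integration.integral_cong refl) (simp add: field_simps)
    also have "\<dots> = ((\<integral>x. p x * X x \<partial>M) + (\<integral>x. q x * X x \<partial>M)) / 2"
      using integrable_payoff[OF X D(1)[OF p] C D(5)[OF p]]
        integrable_payoff[OF X D(1)[OF q] C D(5)[OF q]] by simp
    finally show ?thesis
      using mult_left_mono[OF divergence_midpoint[OF p q C] \<sigma>]
      by (simp add: J_def field_simps)
  qed
  have dec: "decseq A"
  proof (rule decseq_SucI, rule subsetI)
    fix n p assume "p \<in> A (Suc n)"
    moreover have "1 / real (Suc (Suc n)) \<le> 1 / real (Suc n)"
      by (intro divide_left_mono) auto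
    ultimately show "p \<in> A n"
      unfolding A_def by auto
  qed
  have A_ne: "A n \<noteq> {}" for n
    using less_cSUP_iff[OF ne bdd, of "S - 1 / Suc n"] by (force simp: A_def S_def)
  have A_mid: "(\<lambda>x. (p x + q x) / 2) \<in> A n" if "p \<in> A n" "q \<in> A n" for n p q
    using that J_mid[of p q] midpoint_bounded_densities[of p C q] C by (auto simp: A_def)
  have A_int: "(\<integral>\<^sup>+x. ennreal (p x) \<partial>M) \<le> ennreal 1" if "p \<in> A n" for n p
    using that D[of p] by (subst nn_integral_eq_integral) (auto simp: A_def)
  have A_meas: "p \<in> borel_measurable M" if "p \<in> A n" for n p
    using that D(1) by (simp add: A_def)
  have A_nonneg: "0 \<le> p x" if "p \<in> A n" "x \<in> space M" for n p x
    using that D(2) by (simp add: A_def)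
  obtain q p where q: "\<And>k. q k \<in> A k" and p: "p \<in> borel_measurable M" "\<And>x. 0 \<le> p x"
    and conv: "AE x in M. (\<lambda>k. q k x) \<longlonglongrightarrow> p x"
    by (rule decreasing_convex_sets_AE_convergent[where A=A and c=1], rule dec, rule A_ne,
        erule A_meas, erule (1) A_nonneg, erule (1) A_mid, erule A_int, rule that)
  have qC: "q k \<in> bounded_densities C" for k
    using q[of k] by (simp add: A_def)
  have pC: "p \<in> bounded_densities C"
    by (rule bounded_densities_closed[of q]) (fact qC C p conv)+
  have JS: "(\<lambda>k. J (q k)) \<longlonglongrightarrow> S"
  proof (rule tendsto_sandwich)
    show "\<forall>\<^sub>F k in sequentially. S - 1 / Suc k \<le> J (q k)"
      using q by (simp add: A_def)
    show "\<forall>\<^sub>F k in sequentially. J (q k) \<le> S"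
      using qC J_le by simp
    show "(\<lambda>k. S - 1 / Suc k) \<longlonglongrightarrow> S"
      by real_asymp
  qed simp
  have lin: "(\<lambda>k. \<integral>x. q k x * X x \<partial>M) \<longlonglongrightarrow> (\<integral>x. p x * X x \<partial>M)"
    by (rule integral_payoff_tendsto[of X q p C])
      (rule X | rule C | rule conv | rule p(1) | rule D(1)[OF qC] | rule D(5)[OF qC] | rule D(5)[OF pC])+
  have "S \<le> J p"
  proof (cases "\<sigma> = 0")
    case True
    then have "(\<lambda>k. \<integral>x. q k x * X x \<partial>M) \<longlonglongrightarrow> S"
      using JS by (simp add: J_def)
    then have "(\<integral>x. p x * X x \<partial>M) = S"
      using lin by (rule LIMSEQ_unique[rotated])
    then show ?thesis
      by (simp add: J_def True)
  next
    case False
    with \<sigma> have "0 < \<sigma>" by simp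
    let ?L = "((\<integral>x. p x * X x \<partial>M) - S) / \<sigma>"
    have "(\<lambda>k. ((\<integral>x. q k x * X x \<partial>M) - J (q k)) / \<sigma>) \<longlonglongrightarrow> ?L"
      using \<open>0 < \<sigma>\<close> by (intro tendsto_intros lin JS) auto
    \<comment> \<open>Since objective and pay-off converge and \<sigma> is positive, the divergences
      converge as well; lower semicontinuity then compares their limit with the divergence of
      \<open>p\<close>.\<close>
    then have L: "(\<lambda>k. divergence (q k)) \<longlonglongrightarrow> ?L"
      using \<open>0 < \<sigma>\<close> by (simp add: J_def)
    have "ennreal (divergence p) \<le> liminf (\<lambda>k. ennreal (divergence (q k)))"
      using nn_integral_f_liminf[of q p] D(1)[OF qC] conv
      by (simp add: ennreal_divergence[OF D(5)[OF pC]] ennreal_divergence[OF D(5)[OF qC]])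
    also have "\<dots> = ennreal ?L"
      using L by (intro lim_imp_Liminf tendsto_ennrealI) auto
    finally have "divergence p \<le> ?L"
      using LIMSEQ_le_const[OF L] divergence_nonneg by (subst (asm) ennreal_le_iff) auto
    then show ?thesis
      using \<open>0 < \<sigma>\<close> by (simp add: J_def field_simps)
  qed
  then show ?thesis
    using pC J_le unfolding J_def by (meson order_trans)
qed

end

section \<open>From extended-valued functions and conjugates to real integrands\<close>

lemma e2ennreal_le_ennreal_iff:
  assumes "0 \<le> z" "0 \<le> r"
  shows "e2ennreal z \<le> ennreal r \<longleftrightarrow> z \<le> ereal r"
  using assms by (cases z) (auto simp: top_unique)

lemma enn2ereal_le_ereal_iff:
  assumes "0 \<le> r"
  shows "enn2ereal z \<le> ereal r \<longleftrightarrow> z \<le> ennreal r"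
  using assms by (cases z) (auto simp: top_unique)

lemma conjugate_Young: "ereal (x * t) - \<phi> t \<le> conjugate \<phi> x"
  unfolding conjugate_def by (intro SUP_upper) simp

lemma superlinear_integrand_of_finite_conjugate:
  assumes "prob_space P" and nonneg: "\<forall>t. 0 \<le> \<phi> t"
    and cl: "closed_fun \<phi>" and cv: "convex_fun \<phi>" and fin: "finite_valued (conjugate \<phi>)"
  shows "superlinear_integrand P (\<lambda>t. e2ennreal (\<phi> t)) (\<lambda>x. real_of_ereal (conjugate \<phi> x))"
proof -
  interpret prob_space P by fact
  show ?thesis
  proof
    fix c :: ennreal
    show "closed {t. e2ennreal (\<phi> t) \<le> c}"
    proof (cases c)
      case (real r)
      \<comment> \<open>A sublevel set at a finite level is a horizontal section of the closed
        epigraph.\<close>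
      have "{t. e2ennreal (\<phi> t) \<le> c} = (\<lambda>t. (t, r)) -` ereal_epigraph \<phi>"
        using real nonneg by (auto simp: e2ennreal_le_ennreal_iff ereal_epigraph_def)
      then show ?thesis
        using cl unfolding closed_fun_def by (auto intro!: closed_vimage continuous_intros)
    qed simp
  next
    fix a b :: real
    show "2 * e2ennreal (\<phi> ((a + b) / 2)) \<le> e2ennreal (\<phi> a) + e2ennreal (\<phi> b)"
    proof (cases "\<phi> a = \<infinity> \<or> \<phi> b = \<infinity>")
      case False
      then obtain r s where rs: "\<phi> a = ereal r" "\<phi> b = ereal s" "0 \<le> r" "0 \<le> s"
        using nonneg by (metis PInfty_neq_ereal(1) ereal_less_eq(5) ereal_cases MInfty_neq_ereal(1)
            ereal_infty_less_eq(2) zero_ereal_def)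
      then have "(a, r) \<in> ereal_epigraph \<phi>" "(b, s) \<in> ereal_epigraph \<phi>"
        by (auto simp: ereal_epigraph_def)
      then have "(1/2) *\<^sub>R (a, r) + (1/2) *\<^sub>R (b, s) \<in> ereal_epigraph \<phi>"
        using cv unfolding convex_fun_def by (intro convexD) auto
      then have "\<phi> ((a + b) / 2) \<le> ereal ((r + s) / 2)"
        by (simp add: ereal_epigraph_def add_divide_distrib)
      then have "e2ennreal (\<phi> ((a + b) / 2)) \<le> ennreal ((r + s) / 2)"
        using nonneg rs by (subst e2ennreal_le_ennreal_iff) auto
      then have "2 * e2ennreal (\<phi> ((a + b) / 2)) \<le> ennreal 2 * ennreal ((r + s) / 2)"
        by (simp add: mult_left_mono)
      also have "\<dots> = ennreal (r + s)"
        using rs by (subst ennreal_mult[symmetric]) (auto simp del: ennreal_plus)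
      finally show ?thesis
        using rs by simp
    qed auto
  next
    fix x t :: real
    have "ereal (x * t) - \<phi> t \<le> conjugate \<phi> x" by (rule conjugate_Young)
    moreover have "\<bar>conjugate \<phi> x\<bar> \<noteq> \<infinity>" "0 \<le> \<phi> t"
      using fin nonneg by (auto simp: finite_valued_def)
    ultimately show "ennreal (x * t - real_of_ereal (conjugate \<phi> x)) \<le> e2ennreal (\<phi> t)"
      by (cases "\<phi> t"; cases "conjugate \<phi> x") (auto intro!: ennreal_leI)
  qed
qed

text \<open>By Young's inequality the sharp conjugate of v = \<open>conjugate \<phi>\<close> lies
  below \<phi>, and a second conjugation reverses the inequality. Negative \<open>t\<close>, missing
  from the sharp supremum, contribute -\<infinity> since \<phi> is infinite there. This moves
  integrability from \<open>sharp_conjugate \<psi>\<close> to \<open>v\<close>.\<close>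

lemma conjugate_le_sharp_biconjugate:
  assumes nonneg: "\<forall>t. 0 \<le> \<phi> t" and neg: "\<forall>t<0. \<phi> t = \<infinity>"
    and fin: "finite_valued (conjugate \<phi>)" and x: "0 \<le> x"
  shows "conjugate \<phi> x \<le> sharp_conjugate (sharp_conjugate (conjugate \<phi>)) x"
  unfolding conjugate_def[of \<phi> x]
proof (rule SUP_least)
  fix t
  show "ereal (x * t) - \<phi> t \<le> sharp_conjugate (sharp_conjugate (conjugate \<phi>)) x"
  proof (cases "t < 0")
    case False
    have "sharp_conjugate (conjugate \<phi>) t \<le> \<phi> t"
      unfolding sharp_conjugate_def
    proof (rule SUP_least)
      fix z
      have "ereal (z * t) - \<phi> t \<le> conjugate \<phi> z" by (rule conjugate_Young)
      moreover have "\<bar>conjugate \<phi> z\<bar> \<noteq> \<infinity>" "0 \<le> \<phi> t"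
        using fin nonneg by (auto simp: finite_valued_def)
      ultimately show "ereal (z * t) - conjugate \<phi> z \<le> \<phi> t"
        by (cases "\<phi> t"; cases "conjugate \<phi> z") auto
    qed
    then have "ereal (x * t) - \<phi> t \<le> ereal (t * x) - sharp_conjugate (conjugate \<phi>) t"
      by (simp add: ereal_minus_mono mult.commute)
    also have "\<dots> \<le> sharp_conjugate (sharp_conjugate (conjugate \<phi>)) x"
      unfolding sharp_conjugate_def[of "sharp_conjugate (conjugate \<phi>)"]
      using False by (intro SUP_upper) auto
    finally show ?thesis .
  qed (use neg in simp)
qed

text \<open>Iterated doubling carries integrability from the single scale 1 / a to all scales 2^n /
  a, and these eventually dominate any \<open>c\<close>.\<close>

lemma (in prob_space) integrable_scaled_of_doubling:
  fixes w :: "real \<Rightarrow> real"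
  assumes w: "mono w" "\<And>x. x \<le> w x"
    and doubling: "\<And>x. x\<^sub>0 \<le> x \<Longrightarrow> w (2 * x) \<le> k * w x"
    and X[measurable]: "X \<in> borel_measurable M" and a: "0 < a"
    and int: "integrable M (\<lambda>\<theta>. w (\<bar>X \<theta>\<bar> / a))"
  shows "integrable M (\<lambda>\<theta>. w (c * X \<theta>))"
proof -
  have [measurable]: "w \<in> borel_measurable borel"
    using w(1) by (rule borel_measurable_mono)
  have w_nonneg: "0 \<le> w x" if "0 \<le> x" for x
    using w(2)[of x] that by linarith
  \<comment> \<open>Below the threshold, monotonicity supplies the additive constant; the absolute
    value of \<open>k\<close> keeps both summands nonnegative, so one bound serves both
    cases.\<close>
  have step: "w (2 * x) \<le> \<bar>k\<bar> * w x + \<bar>w (2 * x\<^sub>0)\<bar>" if "0 \<le> x" for x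
  proof (cases "x\<^sub>0 \<le> x")
    case True
    then show ?thesis
      using doubling[OF True] mult_right_mono[OF abs_ge_self[of k] w_nonneg[OF that]] by linarith
  next
    case False
    then have "w (2 * x) \<le> w (2 * x\<^sub>0)" using monoD[OF w(1)] by simp
    moreover have "0 \<le> \<bar>k\<bar> * w x" using w_nonneg[OF that] by simp
    ultimately show ?thesis by linarith
  qed
  have pow: "integrable M (\<lambda>\<theta>. w (2 ^ n * (\<bar>X \<theta>\<bar> / a)))" for n
  proof (induction n)
    case (Suc n)
    show ?case
    proof (rule Bochner_Integration.integrable_bound)
      show "integrable M (\<lambda>\<theta>. \<bar>k\<bar> * w (2 ^ n * (\<bar>X \<theta>\<bar> / a)) + \<bar>w (2 * x\<^sub>0)\<bar>)"
        using Suc by simp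
      show "AE \<theta> in M. norm (w (2 ^ Suc n * (\<bar>X \<theta>\<bar> / a)))
          \<le> norm (\<bar>k\<bar> * w (2 ^ n * (\<bar>X \<theta>\<bar> / a)) + \<bar>w (2 * x\<^sub>0)\<bar>)"
      proof (rule AE_I2)
        fix \<theta>
        let ?z = "2 ^ n * (\<bar>X \<theta>\<bar> / a)"
        have "0 \<le> ?z" using a by simp
        moreover have "0 \<le> w (2 * ?z)" using \<open>0 \<le> ?z\<close> by (intro w_nonneg) simp
        ultimately have "norm (w (2 * ?z)) \<le> norm (\<bar>k\<bar> * w ?z + \<bar>w (2 * x\<^sub>0)\<bar>)"
          using step[of ?z] by simp
        then show "norm (w (2 ^ Suc n * (\<bar>X \<theta>\<bar> / a))) \<le> norm (\<bar>k\<bar> * w ?z + \<bar>w (2 * x\<^sub>0)\<bar>)"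
          by (simp add: mult.assoc)
      qed
    qed simp
  qed (use int in simp)
  obtain n where n: "\<bar>c\<bar> * a \<le> 2 ^ n"
    using real_arch_pow[of 2 "\<bar>c\<bar> * a"] by (auto intro: less_imp_le)
  show ?thesis
  proof (rule Bochner_Integration.integrable_bound[OF pow[of n]])
    show "AE \<theta> in M. norm (w (c * X \<theta>)) \<le> norm (w (2 ^ n * (\<bar>X \<theta>\<bar> / a)))"
    proof (rule AE_I2)
      fix \<theta>
      have "\<bar>c\<bar> * a * (\<bar>X \<theta>\<bar> / a) \<le> 2 ^ n * (\<bar>X \<theta>\<bar> / a)"
        using n a by (intro mult_right_mono) auto
      then have le: "\<bar>c * X \<theta>\<bar> \<le> 2 ^ n * (\<bar>X \<theta>\<bar> / a)"
        using a by (simp add: abs_mult)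
      then have "w (c * X \<theta>) \<le> w (2 ^ n * (\<bar>X \<theta>\<bar> / a))"
        by (intro monoD[OF w(1)]) linarith
      \<comment> \<open>Where \<open>w\<close> is negative, its size is controlled by
        \<open>x \<le> w x\<close>, applied at both arguments.\<close>
      moreover have "- w (c * X \<theta>) \<le> w (2 ^ n * (\<bar>X \<theta>\<bar> / a))"
        using w(2)[of "c * X \<theta>"] w(2)[of "2 ^ n * (\<bar>X \<theta>\<bar> / a)"] le by linarith
      ultimately show "norm (w (c * X \<theta>)) \<le> norm (w (2 ^ n * (\<bar>X \<theta>\<bar> / a)))"
        by simp
    qed
  qed simp
qed

section \<open>Maximizers of the GVI and CGVI problems\<close>

theorem corollary17:
  fixes P :: "'a measure"
    and \<phi> v \<psi> :: "real \<Rightarrow> ereal"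
    and m :: "'a \<Rightarrow> 'y \<Rightarrow> real" and y :: "nat \<Rightarrow> 'y" and N :: nat and M\<^sub>N :: "'a \<Rightarrow> real"
    and \<sigma> \<epsilon> :: real
  assumes "prob_space P" and "complete_measure P"
    and "\<forall>t. 0 \<le> \<phi> t"
    and "proper_fun \<phi>" and "closed_fun \<phi>" and "convex_fun \<phi>"
    and "\<phi> 1 = 0" and "\<forall>t<0. \<phi> t = \<infinity>"
    and "v = conjugate \<phi>"
    and "risk_averse_disutility v" and "\<exists>t>0. v t < \<infinity>"
    and "\<psi> = sharp_conjugate v"
    and "N \<ge> 1" and "M\<^sub>N = empirical_payoff m y N"
    and "M\<^sub>N \<in> orlicz_space P (sharp_conjugate \<psi>)"
    and "\<sigma> > 0" and "\<epsilon> \<ge> 0"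
    and "finite_valued v" and "finite_valued \<psi>"
    and "\<exists>x\<^sub>0>0. \<exists>k::real. \<forall>x\<ge>x\<^sub>0. v (2 * x) < ereal k * v x \<and> \<psi> (2 * x) < ereal k * \<psi> x"
  shows "(\<exists>p. is_arg_max (gvi_objective P \<phi> \<sigma> M\<^sub>N) (\<lambda>p. p \<in> densities P) p) \<and>
         (\<exists>p. is_arg_max (\<lambda>p. \<integral>\<theta>. p \<theta> * M\<^sub>N \<theta> \<partial>P) (cgvi_feasible P \<phi> \<epsilon>) p)"
proof -
  define f where "f t = e2ennreal (\<phi> t)" for t
  define w where "w x = real_of_ereal (v x)" for x
  interpret superlinear_integrand P f w
    unfolding f_def[abs_def] w_def[abs_def] \<open>v = conjugate \<phi>\<close>
    by (rule superlinear_integrand_of_finite_conjugate) (use assms in auto)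
  have v: "v x = ereal (w x)" for x
    using \<open>finite_valued v\<close> by (simp add: w_def finite_valued_def ereal_real')
  have w: "mono w" "x \<le> w x" for x
    using \<open>risk_averse_disutility v\<close> by (auto simp: risk_averse_disutility_def mono_def v)
  note [measurable] = borel_measurable_mono[OF w(1)]
  have X[measurable]: "M\<^sub>N \<in> borel_measurable P"
    using assms(15) by (simp add: orlicz_space_def)
  have "payoff M\<^sub>N"
  proof -
    obtain a where a: "0 < a" "nn_expectation P (\<lambda>\<theta>. sharp_conjugate \<psi> (\<bar>M\<^sub>N \<theta>\<bar> / a)) < \<infinity>"
      using assms(15) by (auto simp: orlicz_space_def)
    have "v z \<le> sharp_conjugate \<psi> z" if "0 \<le> z" for z
      using conjugate_le_sharp_biconjugate[of \<phi> z] assms that by simp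
    then have "(\<integral>\<^sup>+\<theta>. ennreal (w (\<bar>M\<^sub>N \<theta>\<bar> / a)) \<partial>P)
        \<le> (\<integral>\<^sup>+\<theta>. e2ennreal (sharp_conjugate \<psi> (\<bar>M\<^sub>N \<theta>\<bar> / a)) \<partial>P)"
      using a(1) unfolding e2ennreal_ereal[symmetric] v[symmetric]
      by (intro nn_integral_mono e2ennreal_mono) auto
    also have "\<dots> < \<infinity>"
      using a(2) unfolding nn_expectation_def by (auto simp: less_top)
    finally have "integrable P (\<lambda>\<theta>. w (\<bar>M\<^sub>N \<theta>\<bar> / a))"
      using w(2) a(1) by (intro integrableI_nonneg) (auto intro!: AE_I2 intro: order_trans[OF _ w(2)])
    moreover obtain x\<^sub>0 k where "\<And>x. x\<^sub>0 \<le> x \<Longrightarrow> w (2 * x) \<le> k * w x"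
      using assms(20) unfolding v by (auto dest: less_imp_le)
    ultimately have "integrable P (\<lambda>\<theta>. w (c * M\<^sub>N \<theta>))" for c
      using integrable_scaled_of_doubling[OF w, of x\<^sub>0 k "M\<^sub>N" a c] X a(1) by simp
    then show ?thesis
      using X by (simp add: payoff_def)
  qed
  have nn_exp: "nn_expectation P (\<lambda>\<theta>. \<phi> (p \<theta>)) = enn2ereal (\<integral>\<^sup>+\<theta>. f (p \<theta>) \<partial>P)" for p
    by (simp add: nn_expectation_def f_def)
  have feasible: "cgvi_feasible P \<phi> c p \<longleftrightarrow> p \<in> bounded_densities c" if "0 \<le> c" for c p
    using that by (simp add: cgvi_feasible_def bounded_densities_def nn_exp enn2ereal_le_ereal_iff)
  have "f 1 = 0"
    by (simp add: f_def \<open>\<phi> 1 = 0\<close> e2ennreal_neg)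
  \<comment> \<open>The constant density 1 makes every constraint set nonempty and is the competitor
    against which densities of large divergence are discarded.\<close>
  then have one: "(\<lambda>_. 1) \<in> bounded_densities c" and div_one: "divergence (\<lambda>_. 1) = 0" for c
    by (auto simp: bounded_densities_def densities_def divergence_def prob_space)
  let ?E = "\<lambda>p. \<integral>\<theta>. p \<theta> * M\<^sub>N \<theta> \<partial>P"
  have "\<exists>p. is_arg_max ?E (cgvi_feasible P \<phi> \<epsilon>) p"
  proof -
    have "bounded_densities \<epsilon> \<noteq> {}" using one by auto
    then obtain p where "p \<in> bounded_densities \<epsilon>"
      "\<And>q. q \<in> bounded_densities \<epsilon> \<Longrightarrow> ?E q - 0 * divergence q \<le> ?E p - 0 * divergence p"
      using penalized_payoff_maximizer[OF \<open>payoff M\<^sub>N\<close> order_refl \<open>\<epsilon> \<ge> 0\<close>] by auto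
    then show ?thesis
      using feasible[OF \<open>\<epsilon> \<ge> 0\<close>] by (auto simp: is_arg_max_def not_less)
  qed
  moreover have "\<exists>p. is_arg_max (gvi_objective P \<phi> \<sigma> M\<^sub>N) (\<lambda>p. p \<in> densities P) p"
  proof -
    let ?J = "\<lambda>p. ?E p - \<sigma> * divergence p"
    define e where "e = (\<integral>\<theta>. envelope M\<^sub>N (\<sigma> / 2) \<theta> \<partial>P)"
    \<comment> \<open>With \<tau> = \<sigma> / 2 the pay-off absorbs half of the penalty, so a
      density of divergence \<open>r\<close> has objective at most e - \<sigma> r / 2. For r > C
      this is below the value of the constant density 1.\<close>
    define C where "C = max 0 (2 * (e - ?E (\<lambda>_. 1)) / \<sigma>)"
    have "0 \<le> C" by (simp add: C_def)
    have "bounded_densities C \<noteq> {}" using one by auto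
    then obtain p where p: "p \<in> bounded_densities C" "\<And>q. q \<in> bounded_densities C \<Longrightarrow> ?J q \<le> ?J p"
      using penalized_payoff_maximizer[OF \<open>payoff M\<^sub>N\<close> less_imp_le[OF \<open>\<sigma> > 0\<close>] \<open>0 \<le> C\<close>] by auto
    have obj: "gvi_objective P \<phi> \<sigma> M\<^sub>N q = ereal (?J q)"
      if "(\<integral>\<^sup>+\<theta>. f (q \<theta>) \<partial>P) = ennreal (divergence q)" for q
      using that divergence_nonneg[of q] by (simp add: gvi_objective_def nn_exp)
    have obj_p: "gvi_objective P \<phi> \<sigma> M\<^sub>N p = ereal (?J p)"
      using p(1) by (intro obj ennreal_divergence[of _ C]) (simp add: bounded_densities_def)
    have "gvi_objective P \<phi> \<sigma> M\<^sub>N q \<le> gvi_objective P \<phi> \<sigma> M\<^sub>N p" if q: "q \<in> densities P" for q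
    proof (cases "\<integral>\<^sup>+\<theta>. f (q \<theta>) \<partial>P")
      case top
      \<comment> \<open>With infinite divergence the objective is -\<infinity>, as \<sigma> is
        positive.\<close>
      then show ?thesis
        using \<open>\<sigma> > 0\<close> by (simp add: gvi_objective_def nn_exp)
    next
      case (real r)
      then have r: "(\<integral>\<^sup>+\<theta>. f (q \<theta>) \<partial>P) = ennreal (divergence q)" "divergence q = r"
        by (auto simp: divergence_def)
      have "?J q \<le> ?J p"
      proof (cases "r \<le> C")
        case True
        then show ?thesis
          using q real p(2)[of q] by (simp add: bounded_densities_def ennreal_leI)
      next
        case False
        have "?E q \<le> \<sigma> / 2 * r + e"
          unfolding e_def using q real \<open>\<sigma> > 0\<close>
          by (intro integral_payoff_le[OF \<open>payoff M\<^sub>N\<close>]) (auto simp: densities_def)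
        moreover have "2 * (e - ?E (\<lambda>_. 1)) / \<sigma> < r"
          using False by (simp add: C_def)
        then have "e - ?E (\<lambda>_. 1) < \<sigma> / 2 * r"
          using \<open>\<sigma> > 0\<close> by (simp add: field_simps)
        moreover have "?E (\<lambda>_. 1) \<le> ?J p"
          using p(2)[OF one] div_one by simp
        ultimately show ?thesis
          unfolding r(2) by (simp add: field_simps)
      qed
      then show ?thesis
        by (simp add: obj[OF r(1)] obj_p)
    qed
    then show ?thesis
      using p(1) by (auto simp: is_arg_max_def bounded_densities_def not_less)
  qed
  ultimately show ?thesis by blast
qed

end
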